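(* Let $(X,d,m)$ be a PI space and $E\subset X$ a bounded $\mathring{BV}$-extension set. Then $E$ is a $BV$-extension set.
   Context: A metric measure space $(X,d,m)$: $(X,d)$ is complete and separable and $m$ is a nonnegative Borel measure finite on bounded sets. $\mathrm{lip}\,u(x)=\limsup_{y\to x}|u(y)-u(x)|/d(x,y)$ if $x$ is an accumulation point, $0$ otherwise. PI space: $m$ is doubling (there is $C_m>0$ with $0<m(B(x,2r))\le C_m\,m(B(x,r))<\infty$ for all $x\in X$, $r>0$) and a $(1,1)$-Poincaré inequality holds: there are $C>0$, $\lambda\ge1$ such that for every locally Lipschitz $u\colon X\to\mathbb{R}$, $x\in X$, $r>0$, $\frac{1}{m(B(x,r))}\int_{B(x,r)}|u-u_{B(x,r)}|\,dm\le \frac{Cr}{m(B(x,\lambda r))}\int_{B(x,\lambda r)}\mathrm{lip}\,u\,dm$, where $u_A$ is the average of $u$ over $A$. For $u\in L^1_{loc}(X)$ and $A$ open, $|Du|(A):=\inf\{\liminf_n\int_A \mathrm{lip}\,u_n\,dm : u_n\in \mathrm{Lip}_{loc}(A),\ u_n\to u \text{ in } L^1_{loc}(m|_A)\}$ ($\mathrm{Lip}_{loc}$: locally Lipschitz); for $B$ Borel, $|Du|(B):=\inf\{|Du|(A): A\supset B \text{ open}\}$. For $B$ Borel and $u\in L^1_{loc}(m|_B)$, $|Du|_B$ is the total variation of $u$ computed in $(X,d,m|_B)$. $\mathring{BV}(B):=\{u\in L^1_{loc}(m|_B): |Du|_B(B)<\infty\}$ with seminorm $\|u\|_{\mathring{BV}(B)}=|Du|_B(B)$;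 $BV(B):=\{u\in L^1(m|_B): |Du|_B(B)<\infty\}$ with norm $\|u\|_{BV(B)}=\|u\|_{L^1(m|_B)}+|Du|_B(B)$. For $\mathscr{A}\in\{\mathring{BV},BV\}$, a Borel set $E$ is an $\mathscr{A}$-extension set if there exist $C\ge1$ and a (not necessarily linear) map $T\colon\mathscr{A}(E)\to\mathscr{A}(X)$ with $Tu=u$ ($m$-a.e.) on $E$ and $\|Tu\|_{\mathscr{A}(X)}\le C\|u\|_{\mathscr{A}(E)}$ for every $u\in\mathscr{A}(E)$. *)

theory Defs
  imports "HOL-Analysis.Analysis"
begin

text \<open>
  The metric space \<open>(X,d)\<close> is the universe of a type of class \<^class>\<open>polish_space\<close> (complete and
  separable, with \<open>d = dist\<close>); functions that the mathematics defines only on a subset, or only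
  almost everywhere, are represented by total functions. Extended nonnegative quantities
  (slopes, variations, norms) take values in \<^typ>\<open>ennreal\<close>.
\<close>

definition metric_measure_space :: "'a::polish_space measure \<Rightarrow> bool" where
  "metric_measure_space m \<longleftrightarrow>
     sets m = sets borel \<and> (\<forall>B\<in>sets borel. bounded B \<longrightarrow> emeasure m B < \<infinity>)"

definition locally_lipschitz_on :: "'a::metric_space set \<Rightarrow> ('a \<Rightarrow> real) \<Rightarrow> bool" where
  "locally_lipschitz_on A u \<longleftrightarrow> (\<forall>x\<in>A. \<exists>r>0. \<exists>L. lipschitz_on L (ball x r \<inter> A) u)"

definition lip :: "('a::metric_space \<Rightarrow> real) \<Rightarrow> 'a \<Rightarrow> ennreal" where
  "lip u x =
     (if x islimpt UNIV then Limsup (at x) (\<lambda>y. ennreal (\<bar>u y - u x\<bar> / dist y x)) else 0)"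

definition doubling :: "'a::metric_space measure \<Rightarrow> bool" where
  "doubling m \<longleftrightarrow> (\<exists>C>0. \<forall>x. \<forall>r>0.
     0 < emeasure m (ball x (2 * r)) \<and>
     emeasure m (ball x (2 * r)) \<le> ennreal C * emeasure m (ball x r) \<and>
     ennreal C * emeasure m (ball x r) < \<infinity>)"

definition average :: "'a measure \<Rightarrow> 'a set \<Rightarrow> ('a \<Rightarrow> real) \<Rightarrow> real" where
  "average m A u = (LINT y:A|m. u y) / measure m A"

definition poincare_1_1 :: "'a::metric_space measure \<Rightarrow> bool" where
  "poincare_1_1 m \<longleftrightarrow> (\<exists>C>0. \<exists>K\<ge>1. \<forall>u x. \<forall>r>0. locally_lipschitz_on UNIV u \<longrightarrow>
     (\<integral>\<^sup>+y\<in>ball x r. ennreal \<bar>u y - average m (ball x r) u\<bar> \<partial>m) / emeasure m (ball x r)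
       \<le> ennreal (C * r) / emeasure m (ball x (K * r)) * (\<integral>\<^sup>+y\<in>ball x (K * r). lip u y \<partial>m))"

definition PI_space :: "'a::polish_space measure \<Rightarrow> bool" where
  "PI_space m \<longleftrightarrow> metric_measure_space m \<and> doubling m \<and> poincare_1_1 m"

text \<open>
  The restriction \<open>m|\<^sub>B\<close> is again a measure on all of \<open>X\<close>, namely \<open>A \<mapsto> m (A \<inter> B)\<close>.
\<close>

definition restr :: "'a measure \<Rightarrow> 'a set \<Rightarrow> 'a measure" where
  "restr m B = density m (indicator B)"

definition L1loc :: "'a::metric_space measure \<Rightarrow> ('a \<Rightarrow> real) set" where
  "L1loc \<mu> = {u \<in> borel_measurable \<mu>. \<forall>x. \<exists>r>0. set_integrable \<mu> (ball x r) u}"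

definition converges_L1loc ::
  "'a::metric_space measure \<Rightarrow> (nat \<Rightarrow> 'a \<Rightarrow> real) \<Rightarrow> ('a \<Rightarrow> real) \<Rightarrow> bool" where
  "converges_L1loc \<mu> v u \<longleftrightarrow> (\<forall>n. v n \<in> L1loc \<mu>) \<and> u \<in> L1loc \<mu> \<and>
     (\<forall>x. \<exists>r>0. (\<lambda>n. \<integral>\<^sup>+y\<in>ball x r. ennreal \<bar>v n y - u y\<bar> \<partial>\<mu>) \<longlonglongrightarrow> 0)"

definition variation_open :: "'a::metric_space measure \<Rightarrow> ('a \<Rightarrow> real) \<Rightarrow> 'a set \<Rightarrow> ennreal" where
  "variation_open \<mu> u A = Inf {liminf (\<lambda>n. \<integral>\<^sup>+y\<in>A. lip (v n) y \<partial>\<mu>) | v.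
     (\<forall>n. locally_lipschitz_on A (v n)) \<and> converges_L1loc (restr \<mu> A) v u}"

text \<open>
  \<open>variation_open \<mu> u\<close> is monotone on open sets, so the following extends it.
\<close>

definition variation :: "'a::metric_space measure \<Rightarrow> ('a \<Rightarrow> real) \<Rightarrow> 'a set \<Rightarrow> ennreal" where
  "variation \<mu> u B = (INF A\<in>{A. open A \<and> B \<subseteq> A}. variation_open \<mu> u A)"

definition BV_hom_norm :: "'a::metric_space measure \<Rightarrow> 'a set \<Rightarrow> ('a \<Rightarrow> real) \<Rightarrow> ennreal" where
  "BV_hom_norm m B u = variation (restr m B) u B"

definition BV_hom :: "'a::metric_space measure \<Rightarrow> 'a set \<Rightarrow> ('a \<Rightarrow> real) set" where
  "BV_hom m B = {u \<in> L1loc (restr m B). variation (restr m B) u B < \<infinity>}"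

definition BV_norm :: "'a::metric_space measure \<Rightarrow> 'a set \<Rightarrow> ('a \<Rightarrow> real) \<Rightarrow> ennreal" where
  "BV_norm m B u = (\<integral>\<^sup>+y. ennreal \<bar>u y\<bar> \<partial>restr m B) + variation (restr m B) u B"

definition BV :: "'a::metric_space measure \<Rightarrow> 'a set \<Rightarrow> ('a \<Rightarrow> real) set" where
  "BV m B = {u. integrable (restr m B) u \<and> variation (restr m B) u B < \<infinity>}"

text \<open>
  The first condition on \<open>T\<close> says that it acts on almost-everywhere equivalence classes. The
  function space and its (semi)norm are parameters; \<open>m\<close> itself is \<open>restr m UNIV\<close>.
\<close>

definition extension_set ::
  "('a measure \<Rightarrow> 'a set \<Rightarrow> ('a \<Rightarrow> real) set) \<Rightarrow>
   ('a measure \<Rightarrow> 'a set \<Rightarrow> ('a \<Rightarrow> real) \<Rightarrow> ennreal) \<Rightarrow>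
   'a::topological_space measure \<Rightarrow> 'a set \<Rightarrow> bool" where
  "extension_set \<A> N m E \<longleftrightarrow> E \<in> sets borel \<and>
     (\<exists>C\<ge>1. \<exists>T.
        (\<forall>u\<in>\<A> m E. \<forall>v\<in>\<A> m E. (AE x in m. x \<in> E \<longrightarrow> u x = v x) \<longrightarrow> (AE x in m. T u x = T v x)) \<and>
        (\<forall>u\<in>\<A> m E. T u \<in> \<A> m UNIV \<and>
           (AE x in m. x \<in> E \<longrightarrow> T u x = u x) \<and>
           N m UNIV (T u) \<le> ennreal C * N m E u))"

definition BV_hom_extension_set :: "'a::metric_space measure \<Rightarrow> 'a set \<Rightarrow> bool" where
  "BV_hom_extension_set = extension_set BV_hom BV_hom_norm"

definition BV_extension_set :: "'a::metric_space measure \<Rightarrow> 'a set \<Rightarrow> bool" where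
  "BV_extension_set = extension_set BV BV_norm"

end

theory Submission
  imports Defs
begin

text \<open>
  Let \<open>T\<close> be the homogeneous extension map. The variation of \<open>T u\<close> is under control, but its
  integral over the whole space is not, so \<open>T u\<close> is multiplied by a Lipschitz cutoff \<open>\<eta>\<close>
  which is \<open>1\<close> on a ball containing \<open>E\<close> and has bounded support. By the Leibniz rule
  (\<open>lip_mult_le\<close>) the full norm of \<open>\<eta> * T u\<close> is at most the variation of \<open>T u\<close> plus a
  constant times the integral of \<open>\<bar>T u\<bar>\<close> over a ball \<open>P\<close>. It remains to bound this integral.

  The Poincare inequality bounds the distance in \<open>L\<^sup>1(P)\<close> from \<open>T u\<close> to a constant \<open>c\<close> by the variation.
  If \<open>E\<close> has positive measure, then \<open>c\<close> itself is controlled by this distance and the integral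
  of \<open>\<bar>T u\<bar> = \<bar>u\<bar>\<close> over \<open>E\<close>, which is part of the norm of \<open>u\<close>
  (\<open>set_nn_integral_le_oscillation\<close>). If \<open>E\<close> is a null set, \<open>0\<close> extends every function.

  The Poincare inequality is available for locally Lipschitz functions, so the estimate is made
  for the approximants in the definition of the variation (\<open>cutoff_BV_norm_le\<close>). These converge
  only near each point; convergence in \<open>L\<^sup>1(P)\<close> follows from compactness of closed balls,
  a consequence of doubling and completeness (\<open>compact_cball_doubling\<close>).
\<close>

section \<open>Balls of a complete doubling space are relatively compact\<close>

lemma doubling_iterate:
  assumes "\<And>x r. r > 0 \<Longrightarrow> emeasure m (ball x (2 * r)) \<le> ennreal C * emeasure m (ball x r)"
    and "r > 0"
  shows "emeasure m (ball x (2 ^ k * r)) \<le> ennreal C ^ k * emeasure m (ball x r)"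
proof (induction k)
  case 0
  show ?case by simp
next
  case (Suc k)
  have "emeasure m (ball x (2 ^ Suc k * r)) \<le> ennreal C * emeasure m (ball x (2 ^ k * r))"
    using assms(1)[of "2 ^ k * r" x] assms(2) by (simp add: mult.assoc)
  also have "\<dots> \<le> ennreal C * (ennreal C ^ k * emeasure m (ball x r))"
    by (intro mult_left_mono Suc.IH) auto
  finally show ?case by (simp add: mult.assoc)
qed

text \<open>
  Disjoint balls of radius \<open>e / 2\<close> around the points of \<open>F\<close> lie in one ball whose mass they each
  carry up to the factor \<open>C ^ k\<close>; hence there cannot be more than \<open>C ^ k\<close> of them.
\<close>

lemma card_separated_le:
  fixes m :: "'a::metric_space measure" and x :: 'a
  assumes sets: "sets m = sets borel" and C: "C > 0"
    and pos: "\<And>x r. r > 0 \<Longrightarrow> 0 < emeasure m (ball x r)"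
    and fin: "\<And>x r. r > 0 \<Longrightarrow> emeasure m (ball x r) < \<infinity>"
    and dbl: "\<And>x r. r > 0 \<Longrightarrow> emeasure m (ball x (2 * r)) \<le> ennreal C * emeasure m (ball x r)"
    and R: "R > 0" and e: "e > 0" and k: "2 ^ k * (e / 2) \<ge> 2 * R + e"
    and F: "finite F" "F \<subseteq> cball x R"
    and sep: "\<And>y z. y \<in> F \<Longrightarrow> z \<in> F \<Longrightarrow> y \<noteq> z \<Longrightarrow> dist y z \<ge> e"
  shows "real (card F) \<le> C ^ k"
proof -
  let ?M = "emeasure m (ball x (R + e))"
  have big: "?M \<le> ennreal (C ^ k) * emeasure m (ball y (e / 2))" if "y \<in> F" for y
  proof -
    have "ball x (R + e) \<subseteq> ball y (2 ^ k * (e / 2))"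
    proof
      fix z assume "z \<in> ball x (R + e)"
      moreover have "dist x y \<le> R" using F(2) that by auto
      ultimately have "dist y z < 2 * R + e"
        using dist_triangle[of y z x] by (simp add: dist_commute)
      then show "z \<in> ball y (2 ^ k * (e / 2))" using k by simp
    qed
    then have "?M \<le> emeasure m (ball y (2 ^ k * (e / 2)))"
      by (intro emeasure_mono) (auto simp: sets)
    also have "\<dots> \<le> ennreal C ^ k * emeasure m (ball y (e / 2))"
      by (rule doubling_iterate[OF dbl]) (use e in auto)
    finally show ?thesis using C by (simp add: ennreal_power)
  qed
  have disj: "disjoint_family_on (\<lambda>y. ball y (e / 2)) F"
    unfolding disjoint_family_on_def
  proof (intro ballI impI)
    fix y z assume "y \<in> F" "z \<in> F" "y \<noteq> z"
    then have "dist y z \<ge> e" using sep by auto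
    then show "ball y (e / 2) \<inter> ball z (e / 2) = {}"
      using dist_triangle_half_r[of _ y e z] by (force simp: dist_commute)
  qed
  have "of_nat (card F) * ?M = (\<Sum>y\<in>F. ?M)" by simp
  also have "\<dots> \<le> (\<Sum>y\<in>F. ennreal (C ^ k) * emeasure m (ball y (e / 2)))"
    by (intro sum_mono big)
  also have "\<dots> = ennreal (C ^ k) * (\<Sum>y\<in>F. emeasure m (ball y (e / 2)))"
    by (simp add: sum_distrib_left)
  also have "(\<Sum>y\<in>F. emeasure m (ball y (e / 2))) = emeasure m (\<Union>y\<in>F. ball y (e / 2))"
    by (intro sum_emeasure disj F(1)) (auto simp: sets)
  also have "ennreal (C ^ k) * \<dots> \<le> ennreal (C ^ k) * ?M"
  proof (intro mult_left_mono emeasure_mono)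
    show "(\<Union>y\<in>F. ball y (e / 2)) \<subseteq> ball x (R + e)"
    proof clarsimp
      fix y z assume "y \<in> F" "dist y z * 2 < e"
      moreover from this have "dist x y \<le> R" using F(2) by auto
      ultimately show "dist x z < R + e"
        using dist_triangle[of x z y] zero_le_dist[of y z] by linarith
    qed
  qed (auto simp: sets)
  finally have le: "of_nat (card F) * ?M \<le> ennreal (C ^ k) * ?M" .
  have "of_nat (card F) \<le> ennreal (C ^ k)"
    using le pos[of "R + e" x] fin[of "R + e" x] R e
    by (subst (asm) (1 2) mult.commute, subst (asm) ennreal_mult_le_mult_iff) auto
  then show ?thesis
    using C by (simp add: ennreal_of_nat_eq_real_of_nat)
qed

text \<open>
  Maximal \<open>e\<close>-separated subsets of a ball exist because their cardinality is bounded, and by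
  maximality they are \<open>e\<close>-nets. So closed balls are totally bounded; they are also complete.
\<close>

lemma compact_cball_doubling:
  fixes m :: "'a::polish_space measure"
  assumes sets: "sets m = sets borel" and "doubling m"
  shows "compact (cball (x :: 'a) R)"
proof (cases "R > 0")
  case False
  then have "cball x R = {} \<or> cball x R = {x}"
    by (cases "R = 0") auto
  then show ?thesis by auto
next
  case R: True
  obtain C where C: "C > 0"
    and D: "\<And>x r. r > 0 \<Longrightarrow> 0 < emeasure m (ball x (2 * r)) \<and>
      emeasure m (ball x (2 * r)) \<le> ennreal C * emeasure m (ball x r) \<and>
      ennreal C * emeasure m (ball x r) < \<infinity>"
    using \<open>doubling m\<close> unfolding doubling_def by metis
  have pos: "0 < emeasure m (ball x r)" if "r > 0" for x r
    using D[of "r / 2" x] that by simp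
  have fin: "emeasure m (ball x r) < \<infinity>" if "r > 0" for x r
    using D[of r x] that C by (auto simp: ennreal_mult_less_top)
  have "\<exists>F. finite F \<and> cball x R \<subseteq> (\<Union>y\<in>F. ball y e)" if e: "e > 0" for e
  proof -
    define P where "P F \<longleftrightarrow> finite F \<and> F \<subseteq> cball x R \<and> (\<forall>y\<in>F. \<forall>z\<in>F. y \<noteq> z \<longrightarrow> dist y z \<ge> e)" for F
    \<comment> \<open>The number of doublings that enlarge a ball of radius \<open>e / 2\<close> to radius \<open>2 * R + e\<close>.\<close>
    obtain k :: nat where "(2 * R + e) / (e / 2) < 2 ^ k"
      using real_arch_pow[of 2] by auto
    then have k: "2 ^ k * (e / 2) \<ge> 2 * R + e"
      using e by (simp add: field_simps)
    have bd: "card F \<le> nat \<lceil>C ^ k\<rceil>" if "P F" for F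
    proof -
      have "real (card F) \<le> C ^ k"
        using card_separated_le[OF sets C pos fin _ R e k, of F x] D that unfolding P_def by auto
      then show ?thesis by linarith
    qed
    have "P {}" by (simp add: P_def)
    then obtain F where F: "P F" "\<And>G. P G \<Longrightarrow> card G \<le> card F"
      using ex_has_greatest_nat[of P "{}" card "Suc (nat \<lceil>C ^ k\<rceil>)"] bd by force
    have "cball x R \<subseteq> (\<Union>y\<in>F. ball y e)"
    proof (rule ccontr)
      assume "\<not> ?thesis"
      then obtain z where z: "z \<in> cball x R" "\<And>y. y \<in> F \<Longrightarrow> dist y z \<ge> e" by force
      then have "z \<notin> F" using e by force
      moreover have "P (insert z F)"
        using F(1) z unfolding P_def by (auto simp: dist_commute)
      ultimately show False
        using F(2)[of "insert z F"] F(1) unfolding P_def by simp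
    qed
    then show ?thesis using F(1) unfolding P_def by auto
  qed
  moreover have "complete (cball x R)" by (simp add: complete_eq_closed)
  ultimately show ?thesis unfolding compact_eq_totally_bounded by blast
qed


section \<open>Local integrability and local convergence on compact sets\<close>

lemma L1loc_set_integrable_compact:
  fixes m :: "'a::metric_space measure"
  assumes sets: "sets m = sets borel" and u: "u \<in> L1loc m"
    and K: "compact K" "A \<subseteq> K" "A \<in> sets borel"
  shows "set_integrable m A u"
proof -
  have "\<forall>x. \<exists>r>0. set_integrable m (ball x r) u"
    using u unfolding L1loc_def by simp
  then obtain r where r: "\<And>x. r x > 0" "\<And>x. set_integrable m (ball x (r x)) u"
    by metis
  have cover: "K \<subseteq> (\<Union>x\<in>K. ball x (r x))" using r(1) by auto
  obtain F where F: "F \<subseteq> K" "finite F" "K \<subseteq> (\<Union>x\<in>F. ball x (r x))"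
    by (rule compactE_image[OF K(1) _ cover]) auto
  have "set_integrable m (\<Union>x\<in>F. ball x (r x)) u"
    using F(2) r(2) by (intro set_integrable_UN) (auto simp: sets)
  then show ?thesis
    by (rule set_integrable_subset) (use F K in \<open>auto simp: sets\<close>)
qed

lemma converges_L1loc_compact:
  fixes m :: "'a::metric_space measure"
  assumes sets: "sets m = sets borel" and conv: "converges_L1loc m v u"
    and K: "compact K" "A \<subseteq> K"
  shows "(\<lambda>n. \<integral>\<^sup>+y\<in>A. ennreal \<bar>v n y - u y\<bar> \<partial>m) \<longlonglongrightarrow> 0"
proof -
  have meas: "v n \<in> borel_measurable m" "u \<in> borel_measurable m" for n
    using conv by (auto simp: converges_L1loc_def L1loc_def)
  have "\<forall>x. \<exists>r>0. (\<lambda>n. \<integral>\<^sup>+y\<in>ball x r. ennreal \<bar>v n y - u y\<bar> \<partial>m) \<longlonglongrightarrow> 0"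
    using conv unfolding converges_L1loc_def by blast
  from choice[OF this] obtain r where
    "\<forall>x. r x > 0 \<and> (\<lambda>n. \<integral>\<^sup>+y\<in>ball x (r x). ennreal \<bar>v n y - u y\<bar> \<partial>m) \<longlonglongrightarrow> 0" ..
  then have r: "\<And>x. r x > 0"
    "\<And>x. (\<lambda>n. \<integral>\<^sup>+y\<in>ball x (r x). ennreal \<bar>v n y - u y\<bar> \<partial>m) \<longlonglongrightarrow> 0"
    by blast+
  have cover: "K \<subseteq> (\<Union>x\<in>K. ball x (r x))" using r(1) by auto
  obtain F where F: "F \<subseteq> K" "finite F" "K \<subseteq> (\<Union>x\<in>F. ball x (r x))"
    by (rule compactE_image[OF K(1) _ cover]) auto
  have le: "(\<integral>\<^sup>+y\<in>A. ennreal \<bar>v n y - u y\<bar> \<partial>m)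
      \<le> (\<Sum>x\<in>F. \<integral>\<^sup>+y\<in>ball x (r x). ennreal \<bar>v n y - u y\<bar> \<partial>m)" for n
  proof -
    have "(\<integral>\<^sup>+y\<in>A. ennreal \<bar>v n y - u y\<bar> \<partial>m)
      \<le> (\<integral>\<^sup>+y. (\<Sum>x\<in>F. ennreal \<bar>v n y - u y\<bar> * indicator (ball x (r x)) y) \<partial>m)"
    proof (intro nn_integral_mono)
      fix y
      show "ennreal \<bar>v n y - u y\<bar> * indicator A y
        \<le> (\<Sum>x\<in>F. ennreal \<bar>v n y - u y\<bar> * indicator (ball x (r x)) y)"
      proof (cases "y \<in> A")
        case True
        then obtain x where x: "x \<in> F" "y \<in> ball x (r x)" using F(3) K(2) by auto
        then have "ennreal \<bar>v n y - u y\<bar> * indicator A y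
          \<le> ennreal \<bar>v n y - u y\<bar> * indicator (ball x (r x)) y" by (auto simp: indicator_def)
        also have "\<dots> \<le> (\<Sum>x\<in>F. ennreal \<bar>v n y - u y\<bar> * indicator (ball x (r x)) y)"
          using x F by (intro member_le_sum) auto
        finally show ?thesis .
      qed simp
    qed
    also have "\<dots> = (\<Sum>x\<in>F. \<integral>\<^sup>+y\<in>ball x (r x). ennreal \<bar>v n y - u y\<bar> \<partial>m)"
      by (rule nn_integral_sum) (use meas in \<open>auto intro!: borel_measurable_times_ennreal
        borel_measurable_indicator simp: sets\<close>)
    finally show ?thesis .
  qed
  have "(\<lambda>n. \<Sum>x\<in>F. \<integral>\<^sup>+y\<in>ball x (r x). ennreal \<bar>v n y - u y\<bar> \<partial>m) \<longlonglongrightarrow> (\<Sum>x\<in>F. 0)"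
    by (intro tendsto_sum r)
  then have "(\<lambda>n. \<Sum>x\<in>F. \<integral>\<^sup>+y\<in>ball x (r x). ennreal \<bar>v n y - u y\<bar> \<partial>m) \<longlonglongrightarrow> 0"
    by simp
  then show ?thesis
    by (rule tendsto_sandwich[OF always_eventually always_eventually tendsto_const, rotated 2])
      (auto simp: le)
qed


section \<open>Integrals of possibly non-measurable functions, and limits in \<open>ennreal\<close>\<close>

text \<open>
  The integral is a lower integral, for which subadditivity can fail. It survives when one summand
  is measurable and finite, because then it can be subtracted from a simple minorant.
  Below, \<open>f\<close> is a slope \<open>lip v\<close> and \<open>g\<close> the error term of the Leibniz rule.
\<close>

lemma nn_integral_add_le:
  assumes g: "g \<in> borel_measurable M" "\<And>x. g x < top"
  shows "(\<integral>\<^sup>+x. f x + g x \<partial>M) \<le> (\<integral>\<^sup>+x. f x \<partial>M) + (\<integral>\<^sup>+x. g x \<partial>M)"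
  unfolding nn_integral_def[of M "\<lambda>x. f x + g x"]
proof (rule SUP_least, clarify)
  fix s assume s: "simple_function M s" "s \<le> (\<lambda>x. f x + g x)"
  have sm: "s \<in> borel_measurable M" by (rule borel_measurable_simple_function[OF s(1)])
  have "integral\<^sup>S M s = (\<integral>\<^sup>+x. s x \<partial>M)"
    by (simp add: nn_integral_eq_simple_integral s(1))
  also have "\<dots> \<le> (\<integral>\<^sup>+x. (s x - g x) + g x \<partial>M)"
    by (intro nn_integral_mono) (auto simp: diff_add_self_ennreal)
  also have "\<dots> = (\<integral>\<^sup>+x. s x - g x \<partial>M) + (\<integral>\<^sup>+x. g x \<partial>M)"
    by (rule nn_integral_add) (use sm g in auto)
  also have "\<dots> \<le> (\<integral>\<^sup>+x. f x \<partial>M) + (\<integral>\<^sup>+x. g x \<partial>M)"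
    using s(2) g(2)
    by (intro add_right_mono nn_integral_mono)
      (auto simp: ennreal_minus_le_iff le_fun_def add.commute less_top[symmetric])
  finally show "integral\<^sup>S M s \<le> (\<integral>\<^sup>+x. f x \<partial>M) + (\<integral>\<^sup>+x. g x \<partial>M)" .
qed

text \<open>
  Along a subsequence on which \<open>I\<close> converges to its lower limit, the right-hand side converges.
\<close>

lemma liminf_le_affine:
  fixes G I h :: "nat \<Rightarrow> ennreal"
  assumes le: "\<And>n. G n \<le> a * I n + h n" and a: "a < top" and h: "h \<longlonglongrightarrow> h0"
  shows "liminf G \<le> a * liminf I + h0"
proof -
  obtain r where r: "strict_mono r" "(I \<circ> r) \<longlonglongrightarrow> liminf I"
    using liminf_subseq_lim by blast
  have "(\<lambda>n. a * (I \<circ> r) n + (h \<circ> r) n) \<longlonglongrightarrow> a * liminf I + h0"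
    by (intro tendsto_add ennreal_tendsto_cmult a r LIMSEQ_subseq_LIMSEQ[OF h])
  then have "liminf (\<lambda>n. a * (I \<circ> r) n + (h \<circ> r) n) = a * liminf I + h0"
    by (rule lim_imp_Liminf[rotated]) simp
  moreover have "liminf (G \<circ> r) \<le> liminf (\<lambda>n. a * (I \<circ> r) n + (h \<circ> r) n)"
    by (intro Liminf_mono always_eventually) (simp add: le)
  ultimately show ?thesis
    using liminf_subseq_mono[OF r(1), of G] by simp
qed

lemma le_affine_Inf:
  fixes X Y a :: ennreal
  assumes le: "\<And>J. J \<in> S \<Longrightarrow> X \<le> a * J + Y" and a: "0 < a" "a < top" and Y: "Y < top"
  shows "X \<le> a * Inf S + Y"
proof -
  have "(X - Y) / a \<le> Inf S"
  proof (rule Inf_greatest)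
    fix J assume "J \<in> S"
    from le[OF this] have "X - Y \<le> a * J"
      using Y by (auto simp: ennreal_minus_le_iff add.commute)
    then show "(X - Y) / a \<le> J" using a by (intro divide_le_posI_ennreal) auto
  qed
  then have "a * ((X - Y) / a) \<le> a * Inf S" by (intro mult_left_mono) auto
  also have "a * ((X - Y) / a) = X - Y"
    using a mult_divide_eq_ennreal[of a "X - Y"] by (simp add: ennreal_times_divide mult.commute)
  finally show ?thesis
    using Y by (auto simp: ennreal_minus_le_iff add.commute)
qed


section \<open>The total variation on the whole space\<close>

lemma restr_UNIV [simp]: "restr m UNIV = m"
  by (simp add: restr_def density_1 indicator_def[abs_def])

lemma variation_UNIV:
  "variation m u UNIV = Inf {liminf (\<lambda>n. \<integral>\<^sup>+y. lip (v n) y \<partial>m) | v.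
     (\<forall>n. locally_lipschitz_on UNIV (v n)) \<and> converges_L1loc m v u}"
proof -
  have "{A :: 'a set. open A \<and> UNIV \<subseteq> A} = {UNIV}" by auto
  then show ?thesis by (simp add: variation_def variation_open_def)
qed

lemma nn_integral_restr:
  assumes "E \<in> sets m" "f \<in> borel_measurable m"
  shows "(\<integral>\<^sup>+x. f x \<partial>restr m E) = (\<integral>\<^sup>+x\<in>E. f x \<partial>m)"
  using assms by (simp add: restr_def nn_integral_density mult.commute)


section \<open>Multiplication by a Lipschitz cutoff\<close>

text \<open>
  The Leibniz rule for the difference quotients
  \<open>\<eta> y * v y - \<eta> x * v x = \<eta> y * (v y - v x) + v x * (\<eta> y - \<eta> x)\<close>.
\<close>

lemma abs_diff_mult_le:
  fixes a b c d :: real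
  assumes "\<bar>a\<bar> \<le> 1"
  shows "\<bar>a * b - c * d\<bar> \<le> \<bar>b - d\<bar> + \<bar>d\<bar> * \<bar>a - c\<bar>"
proof -
  have "\<bar>a * b - c * d\<bar> = \<bar>a * (b - d) + d * (a - c)\<bar>" by (simp add: algebra_simps)
  also have "\<dots> \<le> \<bar>a * (b - d)\<bar> + \<bar>d * (a - c)\<bar>" by (rule abs_triangle_ineq)
  also have "\<dots> \<le> 1 * \<bar>b - d\<bar> + \<bar>d\<bar> * \<bar>a - c\<bar>"
    unfolding abs_mult by (intro add_mono mult_right_mono assms) auto
  finally show ?thesis by simp
qed

lemma locally_lipschitz_on_mult:
  fixes \<eta> v :: "'a::metric_space \<Rightarrow> real"
  assumes eta: "L-lipschitz_on UNIV \<eta>" "\<And>x. \<bar>\<eta> x\<bar> \<le> 1"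
    and v: "locally_lipschitz_on UNIV v"
  shows "locally_lipschitz_on UNIV (\<lambda>x. \<eta> x * v x)"
  unfolding locally_lipschitz_on_def
proof
  fix x :: 'a
  obtain r M where r: "r > 0" "M-lipschitz_on (ball x r \<inter> UNIV) v"
    using v unfolding locally_lipschitz_on_def by blast
  have M: "M \<ge> 0" and L: "L \<ge> 0" using r(2) eta(1) by (auto dest: lipschitz_on_nonneg)
  have "(M + (\<bar>v x\<bar> + M * r) * L)-lipschitz_on (ball x r) (\<lambda>x. \<eta> x * v x)"
  proof (rule lipschitz_onI)
    fix y z assume yz: "y \<in> ball x r" "z \<in> ball x r"
    have "\<bar>v z - v x\<bar> \<le> M * dist z x"
      using lipschitz_onD[OF r(2), of z x] yz r(1) by (simp add: dist_real_def)
    also have "\<dots> \<le> M * r" using yz M by (intro mult_left_mono) (auto simp: dist_commute)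
    finally have vz: "\<bar>v z\<bar> \<le> \<bar>v x\<bar> + M * r" by linarith
    have "dist (\<eta> y * v y) (\<eta> z * v z) \<le> \<bar>v y - v z\<bar> + \<bar>v z\<bar> * \<bar>\<eta> y - \<eta> z\<bar>"
      unfolding dist_real_def by (rule abs_diff_mult_le[OF eta(2)])
    also have "\<dots> \<le> M * dist y z + (\<bar>v x\<bar> + M * r) * (L * dist y z)"
      using lipschitz_onD[OF r(2), of y z] lipschitz_onD[OF eta(1), of y z] yz vz M r(1)
      by (intro add_mono mult_mono) (auto simp: dist_real_def)
    finally show "dist (\<eta> y * v y) (\<eta> z * v z) \<le> (M + (\<bar>v x\<bar> + M * r) * L) * dist y z"
      by (simp add: algebra_simps)
  qed (use M L r(1) in auto)
  then show "\<exists>r>0. \<exists>L. L-lipschitz_on (ball x r \<inter> UNIV) (\<lambda>x. \<eta> x * v x)"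
    using r(1) by auto
qed

lemma lip_mult_le:
  fixes \<eta> v :: "'a::metric_space \<Rightarrow> real"
  assumes eta: "L-lipschitz_on UNIV \<eta>" "\<And>x. \<bar>\<eta> x\<bar> \<le> 1"
  shows "lip (\<lambda>x. \<eta> x * v x) x \<le> lip v x + ennreal (L * \<bar>v x\<bar>)"
proof (cases "x islimpt UNIV")
  case True
  have L: "L \<ge> 0" using eta(1) by (rule lipschitz_on_nonneg)
  have nt: "at x \<noteq> bot" using True by (simp add: trivial_limit_within)
  have "ennreal (\<bar>\<eta> y * v y - \<eta> x * v x\<bar> / dist y x)
    \<le> ennreal (L * \<bar>v x\<bar>) + ennreal (\<bar>v y - v x\<bar> / dist y x)" if "y \<noteq> x" for y
  proof -
    have "\<bar>\<eta> y * v y - \<eta> x * v x\<bar> \<le> \<bar>v y - v x\<bar> + \<bar>v x\<bar> * \<bar>\<eta> y - \<eta> x\<bar>"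
      by (rule abs_diff_mult_le[OF eta(2)])
    also have "\<dots> \<le> \<bar>v y - v x\<bar> + \<bar>v x\<bar> * (L * dist y x)"
      using lipschitz_onD[OF eta(1), of y x]
      by (intro add_left_mono mult_left_mono) (auto simp: dist_real_def)
    finally have "\<bar>\<eta> y * v y - \<eta> x * v x\<bar> / dist y x \<le> L * \<bar>v x\<bar> + \<bar>v y - v x\<bar> / dist y x"
      using that by (simp add: field_simps)
    then show ?thesis
      using L by (simp flip: ennreal_plus)
  qed
  then have "Limsup (at x) (\<lambda>y. ennreal (\<bar>\<eta> y * v y - \<eta> x * v x\<bar> / dist y x))
    \<le> Limsup (at x) (\<lambda>y. ennreal (L * \<bar>v x\<bar>) + ennreal (\<bar>v y - v x\<bar> / dist y x))"
    by (intro Limsup_mono) (auto simp: eventually_at_filter)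
  also have "\<dots> = ennreal (L * \<bar>v x\<bar>) + Limsup (at x) (\<lambda>y. ennreal (\<bar>v y - v x\<bar> / dist y x))"
    by (rule Limsup_const_add[OF nt])
  finally show ?thesis using True by (simp add: lip_def add.commute)
qed (simp add: lip_def)

text \<open>
  Away from the support of the cutoff the product has slope zero, which localises the error term
  \<open>L * \<bar>v x\<bar>\<close> of the Leibniz rule to a ball.
\<close>

lemma lip_eq_0:
  assumes "open U" "x \<in> U" "\<And>y. y \<in> U \<Longrightarrow> f y = 0"
  shows "lip f x = 0"
proof (cases "x islimpt UNIV")
  case True
  have nt: "at x \<noteq> bot" using True by (simp add: trivial_limit_within)
  have "\<forall>\<^sub>F y in at x. y \<in> U"
    using assms(1,2) by (auto simp: eventually_at_topological)
  then have "\<forall>\<^sub>F y in at x. ennreal (\<bar>f y - f x\<bar> / dist y x) = 0"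
    by eventually_elim (simp add: assms(2,3))
  then have "Limsup (at x) (\<lambda>y. ennreal (\<bar>f y - f x\<bar> / dist y x)) = Limsup (at x) (\<lambda>y. 0)"
    by (rule Limsup_eq)
  then show ?thesis using Limsup_const[OF nt, of "0::ennreal"] by (simp add: lip_def)
qed (simp add: lip_def)

lemma L1loc_mult:
  assumes meas: "\<eta> \<in> borel_measurable m" and eta: "\<And>x. \<bar>\<eta> x\<bar> \<le> 1" and u: "u \<in> L1loc m"
    and sets: "sets m = sets borel"
  shows "(\<lambda>x. \<eta> x * u x) \<in> L1loc m"
  unfolding L1loc_def
proof (intro CollectI conjI allI)
  have um: "u \<in> borel_measurable m" using u by (simp add: L1loc_def)
  then show m': "(\<lambda>x. \<eta> x * u x) \<in> borel_measurable m" using meas by simp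
  fix x
  obtain r where r: "r > 0" "set_integrable m (ball x r) u"
    using u unfolding L1loc_def by blast
  have "set_integrable m (ball x r) (\<lambda>x. \<eta> x * u x)"
  proof (rule set_integrable_bound[OF r(2)])
    show "set_borel_measurable m (ball x r) (\<lambda>x. \<eta> x * u x)"
      unfolding set_borel_measurable_def using m'
      by (intro borel_measurable_scaleR borel_measurable_indicator) (auto simp: sets)
    show "AE y in m. y \<in> ball x r \<longrightarrow> norm (\<eta> y * u y) \<le> norm (u y)"
      using eta by (auto simp: abs_mult intro!: mult_left_le_one_le)
  qed
  then show "\<exists>r>0. set_integrable m (ball x r) (\<lambda>x. \<eta> x * u x)" using r(1) by blast
qed

lemma converges_L1loc_mult:
  assumes meas: "\<eta> \<in> borel_measurable m" and eta: "\<And>x. \<bar>\<eta> x\<bar> \<le> 1"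
    and conv: "converges_L1loc m v u" and sets: "sets m = sets borel"
  shows "converges_L1loc m (\<lambda>n x. \<eta> x * v n x) (\<lambda>x. \<eta> x * u x)"
  unfolding converges_L1loc_def
proof (intro conjI allI)
  fix x
  obtain r where r: "r > 0"
    "(\<lambda>n. \<integral>\<^sup>+y\<in>ball x r. ennreal \<bar>v n y - u y\<bar> \<partial>m) \<longlonglongrightarrow> 0"
    using conv unfolding converges_L1loc_def by blast
  have "\<bar>\<eta> y * v n y - \<eta> y * u y\<bar> \<le> \<bar>v n y - u y\<bar>" for n y
    using eta by (auto simp: abs_mult intro!: mult_left_le_one_le simp flip: right_diff_distrib)
  then have "(\<integral>\<^sup>+y\<in>ball x r. ennreal \<bar>\<eta> y * v n y - \<eta> y * u y\<bar> \<partial>m)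
    \<le> (\<integral>\<^sup>+y\<in>ball x r. ennreal \<bar>v n y - u y\<bar> \<partial>m)" for n
    by (intro nn_integral_mono mult_right_mono ennreal_leI) auto
  then have "(\<lambda>n. \<integral>\<^sup>+y\<in>ball x r. ennreal \<bar>\<eta> y * v n y - \<eta> y * u y\<bar> \<partial>m) \<longlonglongrightarrow> 0"
    by (intro tendsto_sandwich[OF _ _ tendsto_const r(2)]) (auto intro: always_eventually)
  then show "\<exists>r>0. (\<lambda>n. \<integral>\<^sup>+y\<in>ball x r. ennreal \<bar>\<eta> y * v n y - \<eta> y * u y\<bar> \<partial>m) \<longlonglongrightarrow> 0"
    using r(1) by blast
qed (use conv in \<open>auto simp: converges_L1loc_def intro!: L1loc_mult[OF meas eta _ sets]\<close>)


lemma Lipschitz_cutoff: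
  fixes x0 :: "'a::metric_space"
  assumes R: "R > 0"
  obtains \<eta> where "(1 / R)-lipschitz_on UNIV \<eta>" "\<And>x. \<bar>\<eta> x :: real\<bar> \<le> 1"
    "\<And>x. x \<in> ball x0 R \<Longrightarrow> \<eta> x = 1" "\<And>x. x \<notin> cball x0 (2 * R) \<Longrightarrow> \<eta> x = 0"
proof
  define \<eta> where "\<eta> x = max 0 (min 1 (2 - dist x0 x / R))" for x
  show "(1 / R)-lipschitz_on UNIV \<eta>"
  proof (rule lipschitz_onI)
    fix y z :: 'a
    have "\<bar>\<eta> y - \<eta> z\<bar> \<le> \<bar>dist x0 y / R - dist x0 z / R\<bar>"
      unfolding \<eta>_def by linarith
    also have "\<dots> = \<bar>dist x0 y - dist x0 z\<bar> / R"
      using R by (simp flip: diff_divide_distrib)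
    also have "\<dots> \<le> dist y z / R"
      using R abs_dist_diff_le[of y x0 z] by (intro divide_right_mono) (auto simp: dist_commute)
    finally show "dist (\<eta> y) (\<eta> z) \<le> 1 / R * dist y z" by (simp add: dist_real_def)
  qed (use R in auto)
  show "\<bar>\<eta> x\<bar> \<le> 1" for x by (simp add: \<eta>_def)
  show "\<eta> x = 1" if "x \<in> ball x0 R" for x
    using that R by (simp add: \<eta>_def max_def min_def field_simps)
  show "\<eta> x = 0" if "x \<notin> cball x0 (2 * R)" for x
    using that R by (simp add: \<eta>_def max_def min_def field_simps)
qed


section \<open>Controlling the integral on a ball by the integral on a subset and the oscillation\<close>

lemma set_nn_integral_triangle:
  fixes f g :: "'a \<Rightarrow> real"
  assumes "f \<in> borel_measurable m" "g \<in> borel_measurable m" "A \<in> sets m"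
  shows "(\<integral>\<^sup>+y\<in>A. ennreal \<bar>f y\<bar> \<partial>m)
    \<le> (\<integral>\<^sup>+y\<in>A. ennreal \<bar>f y - g y\<bar> \<partial>m) + (\<integral>\<^sup>+y\<in>A. ennreal \<bar>g y\<bar> \<partial>m)"
proof -
  have "(\<integral>\<^sup>+y\<in>A. ennreal \<bar>f y\<bar> \<partial>m)
    \<le> (\<integral>\<^sup>+y. ennreal \<bar>f y - g y\<bar> * indicator A y + ennreal \<bar>g y\<bar> * indicator A y \<partial>m)"
  proof (intro nn_integral_mono)
    fix y
    have "ennreal \<bar>f y\<bar> \<le> ennreal \<bar>f y - g y\<bar> + ennreal \<bar>g y\<bar>"
      by (simp flip: ennreal_plus)
    then show "ennreal \<bar>f y\<bar> * indicator A y
      \<le> ennreal \<bar>f y - g y\<bar> * indicator A y + ennreal \<bar>g y\<bar> * indicator A y"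
      by (auto simp: indicator_def)
  qed
  also have "\<dots> = (\<integral>\<^sup>+y\<in>A. ennreal \<bar>f y - g y\<bar> \<partial>m) + (\<integral>\<^sup>+y\<in>A. ennreal \<bar>g y\<bar> \<partial>m)"
    using assms by (intro nn_integral_add) auto
  finally show ?thesis .
qed

text \<open>
  The constant \<open>c\<close>, an average of \<open>v\<close> over \<open>P\<close> in the application, is determined up to the
  oscillation of \<open>v\<close> by the values of \<open>v\<close> on the set \<open>E\<close> of positive measure; this is
  what makes up for a seminorm that does not see constants.
\<close>

lemma set_nn_integral_le_oscillation:
  fixes v w :: "'a \<Rightarrow> real"
  assumes v: "v \<in> borel_measurable m" and w: "w \<in> borel_measurable m"
    and P: "P \<in> sets m" and E: "E \<in> sets m" "E \<subseteq> P"
    and mE: "emeasure m E \<noteq> 0" "emeasure m E < top"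
  defines "q \<equiv> emeasure m P / emeasure m E"
  shows "(\<integral>\<^sup>+y\<in>P. ennreal \<bar>v y\<bar> \<partial>m) \<le> (1 + q) * (\<integral>\<^sup>+y\<in>P. ennreal \<bar>v y - c\<bar> \<partial>m)
    + q * ((\<integral>\<^sup>+y\<in>P. ennreal \<bar>v y - w y\<bar> \<partial>m) + (\<integral>\<^sup>+y\<in>E. ennreal \<bar>w y\<bar> \<partial>m))"
    (is "?V \<le> (1 + q) * ?a + q * (?e + ?U)")
proof -
  have sub: "(\<integral>\<^sup>+y\<in>E. f y \<partial>m) \<le> (\<integral>\<^sup>+y\<in>P. f y \<partial>m)" for f
    using E by (intro nn_integral_mono) (auto simp: indicator_def)
  have "ennreal \<bar>c\<bar> * emeasure m E = (\<integral>\<^sup>+y\<in>E. ennreal \<bar>c\<bar> \<partial>m)"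
    using E by (simp add: nn_integral_cmult_indicator)
  also have "\<dots> \<le> (\<integral>\<^sup>+y\<in>E. ennreal \<bar>c - v y\<bar> \<partial>m) + (\<integral>\<^sup>+y\<in>E. ennreal \<bar>v y\<bar> \<partial>m)"
    by (rule set_nn_integral_triangle) (use v E in auto)
  also have "(\<integral>\<^sup>+y\<in>E. ennreal \<bar>c - v y\<bar> \<partial>m) \<le> ?a"
    using sub by (simp add: abs_minus_commute)
  also have "(\<integral>\<^sup>+y\<in>E. ennreal \<bar>v y\<bar> \<partial>m) \<le> (\<integral>\<^sup>+y\<in>E. ennreal \<bar>v y - w y\<bar> \<partial>m) + ?U"
    by (rule set_nn_integral_triangle) (use v w E in auto)
  also have "(\<integral>\<^sup>+y\<in>E. ennreal \<bar>v y - w y\<bar> \<partial>m) \<le> ?e" by (rule sub)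
  finally have cE: "ennreal \<bar>c\<bar> * emeasure m E \<le> ?a + (?e + ?U)"
    by (simp add: add_mono)
  have "?V \<le> ?a + (\<integral>\<^sup>+y\<in>P. ennreal \<bar>c\<bar> \<partial>m)"
    by (rule set_nn_integral_triangle) (use v P in auto)
  also have "(\<integral>\<^sup>+y\<in>P. ennreal \<bar>c\<bar> \<partial>m) = ennreal \<bar>c\<bar> * emeasure m P"
    using P by (simp add: nn_integral_cmult_indicator)
  also have "\<dots> = q * (ennreal \<bar>c\<bar> * emeasure m E)"
    using mE mult_divide_eq_ennreal[of "emeasure m E" "ennreal \<bar>c\<bar> * emeasure m P"]
    by (simp add: q_def ennreal_times_divide ennreal_divide_times mult.commute mult.left_commute)
  also have "\<dots> \<le> q * (?a + (?e + ?U))" by (intro mult_left_mono cE) auto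
  finally show ?thesis by (simp add: algebra_simps)
qed

text \<open>
  The inequality compares mean values over \<open>ball x r\<close> and over a larger ball; monotonicity of
  the measure turns it into one between integrals, with the slope integrated over the whole space.
\<close>

lemma poincare_oscillation:
  fixes m :: "'a::metric_space measure"
  assumes sets: "sets m = sets borel" and "poincare_1_1 m"
    and pos: "\<And>x r. r > 0 \<Longrightarrow> 0 < emeasure m (ball x r)"
    and fin: "\<And>x r. r > 0 \<Longrightarrow> emeasure m (ball (x :: 'a) r) < top"
  obtains C where "C > 0" "\<And>v x r. r > 0 \<Longrightarrow> locally_lipschitz_on UNIV v \<Longrightarrow>
    \<exists>c. (\<integral>\<^sup>+y\<in>ball x r. ennreal \<bar>v y - c\<bar> \<partial>m) \<le> ennreal (C * r) * (\<integral>\<^sup>+y. lip v y \<partial>m)"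
proof -
  obtain C K where C: "C > 0" and K: "K \<ge> 1"
    and poin: "\<forall>u x. \<forall>r>0. locally_lipschitz_on UNIV u \<longrightarrow>
     (\<integral>\<^sup>+y\<in>ball x r. ennreal \<bar>u y - average m (ball x r) u\<bar> \<partial>m) / emeasure m (ball x r)
       \<le> ennreal (C * r) / emeasure m (ball x (K * r)) * (\<integral>\<^sup>+y\<in>ball x (K * r). lip u y \<partial>m)"
    using assms(2) unfolding poincare_1_1_def by (elim exE conjE) (rule that)
  show ?thesis
  proof (rule that[OF C])
    fix v :: "'a \<Rightarrow> real" and x and r :: real
    assume r: "r > 0" and v: "locally_lipschitz_on UNIV v"
    let ?B = "emeasure m (ball x r)" and ?D = "emeasure m (ball x (K * r))"
    let ?I = "\<integral>\<^sup>+y. lip v y \<partial>m"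
    let ?J = "\<integral>\<^sup>+y\<in>ball x r. ennreal \<bar>v y - average m (ball x r) v\<bar> \<partial>m"
    have Kr: "r \<le> K * r" using K r by simp
    have BD: "?B \<le> ?D" using Kr by (intro emeasure_mono subset_ball) (auto simp: sets)
    have B: "?B \<noteq> 0" "?B < top" using pos[OF r, of x] fin[OF r, of x] by auto
    have D: "?D \<noteq> 0" "?D < top" using pos[of "K * r" x] fin[of "K * r" x] K r by auto
    have "?J = ?J / ?B * ?B"
      using B mult_divide_eq_ennreal[of ?B ?J]
      by (simp add: ennreal_times_divide ennreal_divide_times mult.commute)
    also have "\<dots> \<le> (ennreal (C * r) / ?D * (\<integral>\<^sup>+y\<in>ball x (K * r). lip v y \<partial>m)) * ?D"
      by (intro mult_mono poin[rule_format, OF r v] BD) auto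
    also have "\<dots> = ennreal (C * r) * (\<integral>\<^sup>+y\<in>ball x (K * r). lip v y \<partial>m)"
      using D mult_divide_eq_ennreal[of ?D "ennreal (C * r) * (\<integral>\<^sup>+y\<in>ball x (K * r). lip v y \<partial>m)"]
      by (simp add: ennreal_times_divide ennreal_divide_times mult_ac)
    also have "\<dots> \<le> ennreal (C * r) * ?I"
      by (intro mult_left_mono nn_integral_mono) (auto simp: indicator_def)
    finally show "\<exists>c. (\<integral>\<^sup>+y\<in>ball x r. ennreal \<bar>v y - c\<bar> \<partial>m) \<le> ennreal (C * r) * ?I" by blast
  qed
qed


section \<open>Cutting off is bounded from homogeneous to full norm\<close>

lemma cutoff_slope_integral_le:
  fixes m :: "'a::metric_space measure"
  assumes sets: "sets m = sets borel" and v: "v \<in> borel_measurable m"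
    and eta: "L-lipschitz_on UNIV \<eta>" "\<And>x. \<bar>\<eta> x\<bar> \<le> 1"
    and F: "closed F" "\<And>x. x \<notin> F \<Longrightarrow> \<eta> x = 0" and P: "F \<subseteq> P" "P \<in> sets m"
  shows "(\<integral>\<^sup>+x. lip (\<lambda>x. \<eta> x * v x) x \<partial>m)
    \<le> (\<integral>\<^sup>+x. lip v x \<partial>m) + ennreal L * (\<integral>\<^sup>+x\<in>P. ennreal \<bar>v x\<bar> \<partial>m)"
proof -
  have L: "L \<ge> 0" using eta(1) by (rule lipschitz_on_nonneg)
  have "(\<integral>\<^sup>+x. lip (\<lambda>x. \<eta> x * v x) x \<partial>m)
    \<le> (\<integral>\<^sup>+x. lip v x + ennreal (L * \<bar>v x\<bar>) * indicator P x \<partial>m)"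
  proof (intro nn_integral_mono)
    fix x
    show "lip (\<lambda>x. \<eta> x * v x) x \<le> lip v x + ennreal (L * \<bar>v x\<bar>) * indicator P x"
    proof (cases "x \<in> P")
      case True
      then show ?thesis using lip_mult_le[OF eta] by simp
    next
      case False
      then have "lip (\<lambda>x. \<eta> x * v x) x = 0"
        using F P by (intro lip_eq_0[of "- F"]) auto
      then show ?thesis by simp
    qed
  qed
  also have "\<dots> \<le> (\<integral>\<^sup>+x. lip v x \<partial>m) + (\<integral>\<^sup>+x\<in>P. ennreal (L * \<bar>v x\<bar>) \<partial>m)"
    using v P(2) by (intro nn_integral_add_le) (auto simp: indicator_def)
  also have "(\<integral>\<^sup>+x\<in>P. ennreal (L * \<bar>v x\<bar>) \<partial>m) = ennreal L * (\<integral>\<^sup>+x\<in>P. ennreal \<bar>v x\<bar> \<partial>m)"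
    using L v P(2) by (simp add: ennreal_mult mult.assoc nn_integral_cmult)
  finally show ?thesis .
qed

text \<open>
  The estimates are made for the Lipschitz approximants of \<open>w\<close>, to which the Poincare inequality
  applies, and only then passed to the limit; the approximation error \<open>e n\<close> on the ball
  \<open>P\<close> tends to \<open>0\<close> because \<open>P\<close> is relatively compact.
\<close>

lemma cutoff_BV_norm_le:
  fixes m :: "'a::polish_space measure"
  assumes PI: "PI_space m" and E: "E \<in> sets borel" "bounded E" "emeasure m E \<noteq> 0"
  obtains \<eta> K where "K \<ge> 1" "\<eta> \<in> borel_measurable m" "\<And>x. x \<in> E \<Longrightarrow> \<eta> x = 1"
    "\<And>w. w \<in> BV_hom m UNIV \<Longrightarrow> BV_norm m UNIV (\<lambda>x. \<eta> x * w x)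
      \<le> ennreal K * ((\<integral>\<^sup>+x\<in>E. ennreal \<bar>w x\<bar> \<partial>m) + variation m w UNIV)"
proof -
  have sets: "sets m = sets borel" and bfin: "\<And>B. B \<in> sets borel \<Longrightarrow> bounded B \<Longrightarrow> emeasure m B < top"
    and dbl: "doubling m" and poin: "poincare_1_1 m"
    using PI by (auto simp: PI_space_def metric_measure_space_def)
  have pos: "0 < emeasure m (ball x r)" if "r > 0" for x r
  proof -
    have "0 < emeasure m (ball x (2 * (r / 2)))"
      using dbl that unfolding doubling_def by (metis half_gt_zero)
    then show ?thesis by simp
  qed
  have fin: "emeasure m (ball x r) < top" for x r by (rule bfin) auto
  obtain C where C: "C > 0" "\<And>v x r. r > 0 \<Longrightarrow> locally_lipschitz_on UNIV v \<Longrightarrow>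
    \<exists>c. (\<integral>\<^sup>+y\<in>ball x r. ennreal \<bar>v y - c\<bar> \<partial>m) \<le> ennreal (C * r) * (\<integral>\<^sup>+y. lip v y \<partial>m)"
    by (rule poincare_oscillation[OF sets poin pos fin]) auto
  obtain R x0 where R: "R > 0" "E \<subseteq> ball x0 R"
    using bounded_subset_ballD[OF E(2)] by blast
  obtain \<eta> where eta: "(1 / R)-lipschitz_on UNIV \<eta>" "\<And>x. \<bar>\<eta> x :: real\<bar> \<le> 1"
    "\<And>x. x \<in> ball x0 R \<Longrightarrow> \<eta> x = 1" "\<And>x. x \<notin> cball x0 (2 * R) \<Longrightarrow> \<eta> x = 0"
    using Lipschitz_cutoff[OF R(1), of x0] by metis
  \<comment> \<open>An open ball, as in the Poincare inequality, that contains the closed support of \<open>\<eta>\<close>.\<close>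
  define P where "P = ball x0 (3 * R)"
  have P: "P \<in> sets m" "E \<subseteq> P" "P \<subseteq> cball x0 (3 * R)" "cball x0 (2 * R) \<subseteq> P"
    using R by (auto simp: P_def sets)
  have compact: "compact (cball x0 (3 * R))" by (rule compact_cball_doubling[OF sets dbl])
  have Em: "E \<in> sets m" using E by (simp add: sets)
  have etam: "\<eta> \<in> borel_measurable m"
    using borel_measurable_continuous_onI[OF lipschitz_on_continuous_on[OF eta(1)]]
    by (simp add: measurable_cong_sets[OF sets refl])
  have mE: "emeasure m E < top" by (rule bfin[OF E(1,2)])
  define q where "q = emeasure m P / emeasure m E"
  define p where "p = ennreal (C * (3 * R))"
  define l where "l = 1 + ennreal (1 / R)"
  \<comment> \<open>These are the coefficients that the estimate of \<open>W + G n\<close> below produces.\<close>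
  define a where "a = 1 + l * ((1 + q) * p)"
  define b where "b = l * q"
  have q: "q < top"
    using fin[of x0 "3 * R"] E(3) by (auto simp: q_def P_def less_top[symmetric] ennreal_divide_eq_top_iff)
  have l: "l < top" by (simp add: l_def)
  have a: "0 < a" "a < top"
    using q l by (auto simp: a_def p_def ennreal_mult_less_top intro!: add_pos_nonneg)
  have b: "b < top" using q l by (simp add: b_def ennreal_mult_less_top)
  have main: "BV_norm m UNIV (\<lambda>x. \<eta> x * w x)
      \<le> a * variation m w UNIV + b * (\<integral>\<^sup>+x\<in>E. ennreal \<bar>w x\<bar> \<partial>m)"
    if w: "w \<in> BV_hom m UNIV" for w
  proof -
    have wL: "w \<in> L1loc m" and wm: "w \<in> borel_measurable m"
      using w by (auto simp: BV_hom_def L1loc_def)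
    define U where "U = (\<integral>\<^sup>+x\<in>E. ennreal \<bar>w x\<bar> \<partial>m)"
    define W where "W = (\<integral>\<^sup>+x. ennreal \<bar>\<eta> x * w x\<bar> \<partial>m)"
    have "set_integrable m E w"
      by (rule L1loc_set_integrable_compact[OF sets wL compact]) (use P E in auto)
    then have "(\<integral>\<^sup>+x. ennreal (norm (indicator E x *\<^sub>R w x)) \<partial>m) < \<infinity>"
      unfolding set_integrable_def integrable_iff_bounded by blast
    also have "(\<integral>\<^sup>+x. ennreal (norm (indicator E x *\<^sub>R w x)) \<partial>m) = U"
      unfolding U_def by (intro nn_integral_cong) (auto simp: indicator_def)
    finally have U: "U < top" by simp
    have "BV_norm m UNIV (\<lambda>x. \<eta> x * w x) \<le> a * variation m w UNIV + b * U"
      unfolding variation_UNIV[of m w]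
    proof (rule le_affine_Inf[OF _ a])
      show "b * U < top" using b U by (simp add: ennreal_mult_less_top)
      fix J assume "J \<in> {liminf (\<lambda>n. \<integral>\<^sup>+y. lip (v n) y \<partial>m) | v.
        (\<forall>n. locally_lipschitz_on UNIV (v n)) \<and> converges_L1loc m v w}"
      then obtain v where J: "J = liminf (\<lambda>n. \<integral>\<^sup>+y. lip (v n) y \<partial>m)"
        and v: "\<And>n. locally_lipschitz_on UNIV (v n)" and conv: "converges_L1loc m v w"
        by blast
      have vm: "v n \<in> borel_measurable m" for n
        using conv by (simp add: converges_L1loc_def L1loc_def)
      define I where "I n = (\<integral>\<^sup>+y. lip (v n) y \<partial>m)" for n
      define G where "G n = (\<integral>\<^sup>+y. lip (\<lambda>x. \<eta> x * v n x) y \<partial>m)" for n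
      define V where "V n = (\<integral>\<^sup>+y\<in>P. ennreal \<bar>v n y\<bar> \<partial>m)" for n
      define e where "e n = (\<integral>\<^sup>+y\<in>P. ennreal \<bar>v n y - w y\<bar> \<partial>m)" for n
      have e: "e \<longlonglongrightarrow> 0"
        unfolding e_def[abs_def] by (rule converges_L1loc_compact[OF sets conv compact P(3)])
      have W_le: "W \<le> V n + e n" for n
      proof -
        have "W \<le> (\<integral>\<^sup>+y\<in>P. ennreal \<bar>w y\<bar> \<partial>m)"
          unfolding W_def
        proof (intro nn_integral_mono)
          fix x
          show "ennreal \<bar>\<eta> x * w x\<bar> \<le> ennreal \<bar>w x\<bar> * indicator P x"
            using eta(2)[of x] eta(4)[of x] subsetD[OF P(4), of x]
            by (cases "x \<in> P") (auto simp: abs_mult intro!: ennreal_leI mult_left_le_one_le)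
        qed
        also have "\<dots> \<le> (\<integral>\<^sup>+y\<in>P. ennreal \<bar>w y - v n y\<bar> \<partial>m) + V n"
          unfolding V_def by (rule set_nn_integral_triangle[OF wm vm P(1)])
        finally show ?thesis by (simp add: e_def abs_minus_commute add.commute)
      qed
      have G_le: "G n \<le> I n + ennreal (1 / R) * V n" for n
        unfolding G_def I_def V_def
        by (rule cutoff_slope_integral_le[OF sets vm eta(1,2) closed_cball eta(4) P(4,1)])
      have V_le: "V n \<le> (1 + q) * (p * I n) + q * (e n + U)" for n
      proof -
        obtain c where c: "(\<integral>\<^sup>+y\<in>P. ennreal \<bar>v n y - c\<bar> \<partial>m) \<le> p * I n"
          using C(2)[of "3 * R" "v n" x0] v R(1) unfolding P_def p_def I_def by auto
        have "V n \<le> (1 + q) * (\<integral>\<^sup>+y\<in>P. ennreal \<bar>v n y - c\<bar> \<partial>m) + q * (e n + U)"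
          unfolding V_def e_def U_def q_def
          by (rule set_nn_integral_le_oscillation[OF vm wm P(1) Em P(2) E(3) mE])
        also have "\<dots> \<le> (1 + q) * (p * I n) + q * (e n + U)"
          by (intro add_right_mono mult_left_mono c) auto
        finally show ?thesis .
      qed
      define h where "h n = b * (e n + U) + e n" for n
      have "W + G n \<le> a * I n + h n" for n
      proof -
        have "W + G n \<le> (V n + e n) + (I n + ennreal (1 / R) * V n)"
          by (intro add_mono W_le G_le)
        also have "\<dots> = I n + l * V n + e n" by (simp add: l_def algebra_simps)
        also have "\<dots> \<le> I n + l * ((1 + q) * (p * I n) + q * (e n + U)) + e n"
          by (intro add_mono mult_left_mono V_le) auto
        also have "\<dots> = a * I n + h n" by (simp add: a_def b_def h_def algebra_simps)
        finally show ?thesis .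
      qed
      moreover have "h \<longlonglongrightarrow> b * (0 + U) + 0"
        unfolding h_def[abs_def] by (intro tendsto_add ennreal_tendsto_cmult b e tendsto_const)
      ultimately have "liminf (\<lambda>n. W + G n) \<le> a * liminf I + (b * (0 + U) + 0)"
        by (rule liminf_le_affine[OF _ a(2)])
      moreover have "variation m (\<lambda>x. \<eta> x * w x) UNIV \<le> liminf G"
        unfolding variation_UNIV G_def[abs_def]
        using locally_lipschitz_on_mult[OF eta(1,2) v]
          converges_L1loc_mult[OF etam eta(2) conv sets]
        by (intro Inf_lower CollectI exI[of _ "\<lambda>n x. \<eta> x * v n x"]) auto
      ultimately show "BV_norm m UNIV (\<lambda>x. \<eta> x * w x) \<le> a * J + b * U"
        unfolding BV_norm_def
        by (simp add: J I_def[abs_def] W_def Liminf_const_add add_left_mono order_trans[rotated])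
    qed
    then show ?thesis by (simp add: U_def)
  qed
  define K where "K = max 1 (enn2real (a + b))"
  have "a + b = ennreal (enn2real (a + b))" using a b by simp
  also have "\<dots> \<le> ennreal K" by (intro ennreal_leI) (simp add: K_def)
  finally have K: "a + b \<le> ennreal K" .
  show ?thesis
  proof (rule that[of K \<eta>])
    fix w assume w: "w \<in> BV_hom m UNIV"
    let ?U = "\<integral>\<^sup>+x\<in>E. ennreal \<bar>w x\<bar> \<partial>m" and ?D = "variation m w UNIV"
    have "a * ?D + b * ?U \<le> (a + b) * ?D + (a + b) * ?U"
      by (intro add_mono mult_right_mono) auto
    also have "\<dots> \<le> ennreal K * (?U + ?D)"
      using mult_right_mono[OF K, of "?U + ?D"] by (simp add: algebra_simps)
    finally show "BV_norm m UNIV (\<lambda>x. \<eta> x * w x) \<le> ennreal K * (?U + ?D)"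
      using main[OF w] by simp
  qed (use etam eta(3) R in \<open>auto simp: K_def\<close>)
qed


section \<open>The extension\<close>

lemma BV_subset_BV_hom:
  fixes m :: "'a::metric_space measure"
  assumes sets: "sets m = sets borel"
  shows "BV m E \<subseteq> BV_hom m E"
proof
  fix u assume u: "u \<in> BV m E"
  then have int: "integrable (restr m E) u" by (simp add: BV_def)
  have "set_integrable (restr m E) (ball x 1) u" for x
    unfolding set_integrable_def
    by (rule integrable_mult_indicator[OF _ int]) (simp add: restr_def sets)
  then have "u \<in> L1loc (restr m E)"
    using int unfolding L1loc_def by (auto intro: exI[of _ 1])
  then show "u \<in> BV_hom m E" using u by (simp add: BV_def BV_hom_def)
qed

lemma lip_zero: "lip (\<lambda>_. 0) x = 0"
  by (rule lip_eq_0[of UNIV]) auto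

lemma BV_norm_zero:
  fixes m :: "'a::metric_space measure"
  shows "BV_norm m UNIV (\<lambda>_. 0) = 0"
proof -
  have "converges_L1loc m (\<lambda>_ _. 0) (\<lambda>_. 0)"
    by (auto simp: converges_L1loc_def L1loc_def set_integrable_def intro: exI[of _ "1::real"])
  moreover have "locally_lipschitz_on UNIV (\<lambda>_ :: 'a. 0)"
    unfolding locally_lipschitz_on_def
    by (rule ballI, rule exI[of _ "1::real"], rule conjI, simp, rule exI[of _ "0::real"],
      rule lipschitz_on_constant)
  ultimately have "variation m (\<lambda>_. 0) UNIV \<le> liminf (\<lambda>n::nat. \<integral>\<^sup>+y. lip (\<lambda>_. 0 :: real) y \<partial>m)"
    unfolding variation_UNIV
    by (intro Inf_lower CollectI exI[of _ "\<lambda>_ _. 0"]) auto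
  then show ?thesis by (simp add: BV_norm_def lip_zero Liminf_const)
qed

theorem proposition4p5:
  fixes m :: "'a::polish_space measure" and E :: "'a set"
  assumes "PI_space m"
    and "bounded E"
    and "BV_hom_extension_set m E"
  shows "BV_extension_set m E"
proof -
  have sets: "sets m = sets borel"
    using assms(1) by (simp add: PI_space_def metric_measure_space_def)
  have inBV: "f \<in> BV m UNIV" if "f \<in> borel_measurable m" "BV_norm m UNIV f < top" for f
    using that by (auto simp: BV_def BV_norm_def integrable_iff_bounded)
  obtain C T where E: "E \<in> sets borel" and C: "C \<ge> 1"
    and T_cong: "\<And>u v. u \<in> BV_hom m E \<Longrightarrow> v \<in> BV_hom m E \<Longrightarrow>
      (AE x in m. x \<in> E \<longrightarrow> u x = v x) \<Longrightarrow> (AE x in m. T u x = T v x)"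
    and T: "\<And>u. u \<in> BV_hom m E \<Longrightarrow> T u \<in> BV_hom m UNIV"
      "\<And>u. u \<in> BV_hom m E \<Longrightarrow> AE x in m. x \<in> E \<longrightarrow> T u x = u x"
      "\<And>u. u \<in> BV_hom m E \<Longrightarrow> BV_hom_norm m UNIV (T u) \<le> ennreal C * BV_hom_norm m E u"
    using assms(3) unfolding BV_hom_extension_set_def extension_set_def by blast
  have hom: "u \<in> BV_hom m E" if "u \<in> BV m E" for u
    using BV_subset_BV_hom[OF sets] that by blast
  show ?thesis
  proof (cases "emeasure m E = 0")
    case True
    have "AE x in m. x \<notin> E"
      using True E by (intro AE_not_in) (simp add: null_sets_def sets)
    then have *: "AE x in m. x \<in> E \<longrightarrow> u x = 0" for u :: "'a \<Rightarrow> real" by auto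
    show ?thesis
      unfolding BV_extension_set_def extension_set_def
      by (rule conjI[OF E], rule exI[of _ 1], rule conjI, simp, rule exI[of _ "\<lambda>_ _. 0"])
        (auto simp: BV_norm_zero * intro!: inBV)
  next
    case False
    obtain \<eta> K where K: "K \<ge> 1" and etam: "\<eta> \<in> borel_measurable m"
      and eta: "\<And>x. x \<in> E \<Longrightarrow> \<eta> x = 1"
      and bound: "\<And>w. w \<in> BV_hom m UNIV \<Longrightarrow> BV_norm m UNIV (\<lambda>x. \<eta> x * w x)
      \<le> ennreal K * ((\<integral>\<^sup>+x\<in>E. ennreal \<bar>w x\<bar> \<partial>m) + variation m w UNIV)"
      by (rule cutoff_BV_norm_le[OF assms(1) E assms(2) False]) (rule that)
    define S where "S u x = \<eta> x * T u x" for u x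
    have norm: "BV_norm m UNIV (S u) \<le> ennreal (K * C) * BV_norm m E u" if "u \<in> BV m E" for u
    proof -
      note Tu = T[OF hom[OF that]]
      have um: "u \<in> borel_measurable m"
        using that by (auto simp: BV_def restr_def dest: borel_measurable_integrable)
      have "(\<integral>\<^sup>+x\<in>E. ennreal \<bar>T u x\<bar> \<partial>m) = (\<integral>\<^sup>+x\<in>E. ennreal \<bar>u x\<bar> \<partial>m)"
        using Tu(2) by (intro nn_integral_cong_AE) (auto simp: indicator_def)
      also have "\<dots> = (\<integral>\<^sup>+x. ennreal \<bar>u x\<bar> \<partial>restr m E)"
        using um E by (intro nn_integral_restr[symmetric]) (auto simp: sets)
      finally have L1: "(\<integral>\<^sup>+x\<in>E. ennreal \<bar>T u x\<bar> \<partial>m) = (\<integral>\<^sup>+x. ennreal \<bar>u x\<bar> \<partial>restr m E)" .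
      have "BV_norm m UNIV (S u) \<le> ennreal K * ((\<integral>\<^sup>+x. ennreal \<bar>u x\<bar> \<partial>restr m E)
          + variation m (T u) UNIV)"
        using bound[OF Tu(1)] by (simp add: S_def[abs_def] L1)
      also have "\<dots> \<le> ennreal K * (ennreal C * (\<integral>\<^sup>+x. ennreal \<bar>u x\<bar> \<partial>restr m E)
          + ennreal C * variation (restr m E) u E)"
        using Tu(3) mult_right_mono[of 1 "ennreal C" "\<integral>\<^sup>+x. ennreal \<bar>u x\<bar> \<partial>restr m E"] C
        by (intro mult_left_mono add_mono) (auto simp: BV_hom_norm_def)
      also have "\<dots> = ennreal (K * C) * BV_norm m E u"
        using K C by (simp add: BV_norm_def ennreal_mult algebra_simps)
      finally show ?thesis .
    qed
    have S_in: "S u \<in> BV m UNIV" if u: "u \<in> BV m E" for u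
    proof (rule inBV)
      show "S u \<in> borel_measurable m"
        using etam T(1)[OF hom[OF u]] unfolding S_def[abs_def]
        by (intro borel_measurable_times) (auto simp: BV_hom_def L1loc_def)
      have "BV_norm m E u < top"
        using u by (auto simp: BV_def BV_norm_def integrable_iff_bounded)
      then show "BV_norm m UNIV (S u) < top"
        using norm[OF u] by (auto simp: ennreal_mult_less_top intro: le_less_trans)
    qed
    have S_ext: "AE x in m. x \<in> E \<longrightarrow> S u x = u x" if "u \<in> BV m E" for u
      using T(2)[OF hom[OF that]] by eventually_elim (simp add: S_def eta)
    have S_cong: "AE x in m. S u x = S v x"
      if "u \<in> BV m E" "v \<in> BV m E" "AE x in m. x \<in> E \<longrightarrow> u x = v x" for u v
      using T_cong[OF hom[OF that(1)] hom[OF that(2)] that(3)]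
      by eventually_elim (simp add: S_def)
    have "K * C \<ge> 1" using K C mult_mono[of 1 K 1 C] by simp
    then show ?thesis
      unfolding BV_extension_set_def extension_set_def
      using E norm S_in S_ext S_cong by blast
  qed
qed

end
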